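(* Let $\mathcal I$ be an ideal on $\mathbb N$. The following conditions are equivalent. (1) For every sequence $(a_n)_{n\in\mathbb N}$ of non-negative reals: if $\sum_{n=1}^\infty a_n<\infty$ then $\mathcal I\text{-}\lim n a_n=0$. (2) For every sequence $(a_n)_{n\in\mathbb N}$ of non-negative reals: if $\sum_{n=1}^\infty a_n<\infty$ then $\mathcal I^*\text{-}\lim n a_n=0$. (3) $\mathcal I_{1/n}\subseteq\mathcal I$.
   Context: $\mathbb N=\{1,2,\dots\}$. An ideal on $\mathbb N$ is a nonempty family $\mathcal I\subseteq\mathcal P(\mathbb N)$ closed under subsets and finite unions, containing all finite subsets of $\mathbb N$, with $\mathbb N\notin\mathcal I$. $\mathcal I^*=\{\mathbb N\setminus A: A\in\mathcal I\}$ is the dual filter. For a real sequence $(x_n)$: $\mathcal I\text{-}\lim x_n=L$ means $\{n\in\mathbb N:|x_n-L|\ge\varepsilon\}\in\mathcal I$ for every $\varepsilon>0$; $\mathcal I^*\text{-}\lim x_n=L$ means there is $F\in\mathcal I^*$ such that the subsequence $(x_n)_{n\in F}$ converges to $L$ in the ordinary sense. The summable ideal is $\mathcal I_{1/n}=\{A\subseteq\mathbb N:\sum_{n\in A}\frac1n<\infty\}$. *)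

theory Defs
  imports "HOL-Analysis.Analysis"
begin

text \<open>The natural numbers start at 1 here. They are rendered as the set \<open>{1..}\<close> of type
  \<open>nat set\<close>, and a sequence indexed by them is a function on \<open>nat\<close> whose value at 0 is
  never used.\<close>

abbreviation pos_nats :: "nat set" where
  "pos_nats \<equiv> {1..}"

definition ideal_on_nats :: "nat set set \<Rightarrow> bool" where
  "ideal_on_nats I \<longleftrightarrow>
     I \<noteq> {} \<and> I \<subseteq> Pow pos_nats \<and>
     (\<forall>A B. A \<in> I \<longrightarrow> B \<subseteq> A \<longrightarrow> B \<in> I) \<and>
     (\<forall>A B. A \<in> I \<longrightarrow> B \<in> I \<longrightarrow> A \<union> B \<in> I) \<and>
     (\<forall>A. A \<subseteq> pos_nats \<longrightarrow> finite A \<longrightarrow> A \<in> I) \<and>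
     pos_nats \<notin> I"

definition dual_filter :: "nat set set \<Rightarrow> nat set set" where
  "dual_filter I = {pos_nats - A | A. A \<in> I}"

definition ideal_lim :: "nat set set \<Rightarrow> (nat \<Rightarrow> real) \<Rightarrow> real \<Rightarrow> bool" where
  "ideal_lim I x L \<longleftrightarrow> (\<forall>\<epsilon>>0. {n \<in> pos_nats. \<bar>x n - L\<bar> \<ge> \<epsilon>} \<in> I)"

text \<open>The subsequence of \<open>x\<close> along \<open>F\<close> is \<open>x\<close> composed with the increasing enumeration of
  \<open>F\<close>. Members of the dual filter are always infinite, as the lemma below shows, so the
  enumeration is the intended one.\<close>

definition ideal_star_lim :: "nat set set \<Rightarrow> (nat \<Rightarrow> real) \<Rightarrow> real \<Rightarrow> bool" where
  "ideal_star_lim I x L \<longleftrightarrow>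
     (\<exists>F \<in> dual_filter I. (\<lambda>k. x (enumerate F k)) \<longlonglongrightarrow> L)"

definition summable_ideal :: "nat set set" where
  "summable_ideal = {A. A \<subseteq> pos_nats \<and> (\<lambda>n. 1 / real n) summable_on A}"

lemma infinite_dual_filter:
  assumes "ideal_on_nats I" and "F \<in> dual_filter I"
  shows "infinite F"
proof
  assume fin: "finite F"
  obtain A where A: "A \<in> I" "F = pos_nats - A"
    using assms(2) by (auto simp: dual_filter_def)
  have sub: "A \<subseteq> pos_nats" using A(1) assms(1) by (auto simp: ideal_on_nats_def)
  have F: "F \<in> I" using fin A(2) assms(1) by (simp add: ideal_on_nats_def)
  have "A \<union> F \<in> I" using A(1) F assms(1) by (simp add: ideal_on_nats_def)
  moreover have "A \<union> F = pos_nats" using A(2) sub by blast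
  ultimately show False using assms(1) by (simp add: ideal_on_nats_def)
qed

end

theory Submission
  imports Defs
begin

text \<open>The step from (3) to (2) is Abel--Dini. With the square roots \<open>s n\<close> of the tails
  of \<open>\<Sum> a n\<close>, one has \<open>a n = (s n)\<^sup>2 - (s (n + 1))\<^sup>2 \<le> 2 * s n * (s n - s (n + 1))\<close>.
  Hence \<open>1 / n \<le> 2 * (s n - s (n + 1))\<close> whenever \<open>n * a n > s n\<close>: these \<open>n\<close> form a set of
  the summable ideal, and off this set \<open>n * a n\<close> is at most \<open>s n\<close>, which tends to 0.\<close>

text \<open>Along \<open>F\<close> the terms stay within \<open>e\<close> of \<open>L\<close> from
  position \<open>K\<close> of the enumeration on. So an \<open>n\<close> with error at least
  \<open>e\<close> lies in \<open>A\<close> or comes before \<open>enumerate F K\<close>, and the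
  ideal contains \<open>A\<close> and all finite sets of positive integers.\<close>

lemma ideal_star_lim_imp_ideal_lim:
  assumes I: "ideal_on_nats I" and "ideal_star_lim I x L"
  shows "ideal_lim I x L"
  unfolding ideal_lim_def
proof (intro allI impI)
  fix e :: real assume "e > 0"
  obtain A where A: "A \<in> I" and lim: "(\<lambda>k. x (enumerate (pos_nats - A) k)) \<longlonglongrightarrow> L"
    using assms(2) by (auto simp: ideal_star_lim_def dual_filter_def)
  define F where "F = pos_nats - A"
  have inf: "infinite F"
    using infinite_dual_filter[OF I, of F] A by (auto simp: F_def dual_filter_def)
  obtain K where K: "\<And>k. k \<ge> K \<Longrightarrow> \<bar>x (enumerate F k) - L\<bar> < e"
    using LIMSEQ_D[OF lim \<open>e > 0\<close>] by (auto simp: F_def)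
  have "{n \<in> pos_nats. \<bar>x n - L\<bar> \<ge> e} \<subseteq> A \<union> {1..enumerate F K}"
  proof
    fix n assume n: "n \<in> {n \<in> pos_nats. \<bar>x n - L\<bar> \<ge> e}"
    show "n \<in> A \<union> {1..enumerate F K}"
    proof (cases "n \<in> A")
      case False
      with n have "n \<in> F" by (simp add: F_def)
      then obtain k where k: "enumerate F k = n" using enumerate_Ex[OF inf] by blast
      with K[of k] n have "k < K" by fastforce
      then have "n < enumerate F K" using enumerate_mono[OF _ inf] k by blast
      with n show ?thesis by auto
    qed simp
  qed
  moreover have "A \<union> {1..enumerate F K} \<in> I"
    using I A by (auto simp: ideal_on_nats_def)
  ultimately show "{n \<in> pos_nats. \<bar>x n - L\<bar> \<ge> e} \<in> I"
    using I by (simp add: ideal_on_nats_def)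
qed

lemma suminf_tail_tendsto_0:
  fixes a :: "nat \<Rightarrow> real"
  assumes "summable a"
  shows "(\<lambda>n. \<Sum>k. a (k + n)) \<longlonglongrightarrow> 0"
proof -
  have "(\<lambda>n. suminf a - sum a {..<n}) \<longlonglongrightarrow> suminf a - suminf a"
    by (intro tendsto_intros summable_LIMSEQ assms)
  then show ?thesis by (simp add: suminf_minus_initial_segment[OF assms])
qed

lemma summable_on_inverse_sqrt_tail:
  fixes a :: "nat \<Rightarrow> real"
  assumes nonneg: "\<And>n. a n \<ge> 0" and sum: "summable a"
  shows "(\<lambda>n. 1 / real n) summable_on {n. real n * a n > sqrt (\<Sum>k. a (k + n))}"
proof -
  define R where "R n = (\<Sum>k. a (k + n))" for n
  define s where "s n = sqrt (R n)" for n
  have R_nonneg: "R n \<ge> 0" for n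
    unfolding R_def by (intro suminf_nonneg summable_ignore_initial_segment sum nonneg)
  have R_Suc: "R n - R (Suc n) = a n" for n
    using suminf_split_head[OF summable_ignore_initial_segment[OF sum, of n]]
    by (simp add: R_def)
  have s_nonneg: "s n \<ge> 0" for n by (simp add: s_def R_nonneg)
  have s_Suc: "s (Suc n) \<le> s n" for n
    using R_Suc[of n] nonneg[of n] by (simp add: s_def)
  have "s \<longlonglongrightarrow> 0"
    using tendsto_real_sqrt[OF suminf_tail_tendsto_0[OF sum]] by (simp add: s_def[abs_def] R_def)
  \<comment> \<open>The series telescopes and \<open>s\<close> converges. Its terms are nonnegative
    because \<open>s\<close> decreases, so the convergence is absolute and summability passes to
    subsets of the index set.\<close>
  then have "summable (\<lambda>n. 2 * (s n - s (Suc n)))"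
    by (intro summable_mult telescope_summable')
  then have "(\<lambda>n. 2 * (s n - s (Suc n))) summable_on UNIV"
    by (intro norm_summable_imp_summable_on) (simp add: s_Suc)
  then have g: "(\<lambda>n. 2 * (s n - s (Suc n))) summable_on {n. real n * a n > s n}"
    by (rule summable_on_subset_banach) simp
  have "(\<lambda>n. 1 / real n) summable_on {n. real n * a n > s n}"
  proof (rule summable_on_comparison_test[OF g])
    fix n assume "n \<in> {n. real n * a n > s n}"
    then have n: "s n < real n * a n" by simp
    \<comment> \<open>For \<open>n = 0\<close> the product is 0 and cannot exceed
      \<open>s 0\<close>, which is nonnegative.\<close>
    then have npos: "real n > 0"
      using s_nonneg[of n] by (cases n) auto
    \<comment> \<open>Since \<open>R n = a n + R (Suc n)\<close>, positivity of \<open>a n\<close>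
      passes to \<open>R n\<close> and hence to \<open>s n\<close>; this is what allows the factor
      \<open>s n\<close> to be cancelled below.\<close>
    have "a n > 0"
      using n s_nonneg[of n] npos by (metis order.strict_trans1 zero_less_mult_pos)
    then have spos: "s n > 0"
      using R_Suc[of n] R_nonneg[of "Suc n"] by (simp add: s_def)
    have "a n = (s n)\<^sup>2 - (s (Suc n))\<^sup>2"
      using R_Suc[of n] R_nonneg by (simp add: s_def)
    also have "\<dots> = (s n + s (Suc n)) * (s n - s (Suc n))"
      by (simp add: power2_eq_square algebra_simps)
    also have "\<dots> \<le> (2 * s n) * (s n - s (Suc n))"
      using s_Suc[of n] by (intro mult_right_mono) auto
    finally have "real n * a n \<le> real n * ((2 * s n) * (s n - s (Suc n)))"
      using npos by simp
    with n have "s n * 1 < s n * (real n * (2 * (s n - s (Suc n))))"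
      by (simp add: algebra_simps)
    then have "1 < real n * (2 * (s n - s (Suc n)))"
      using spos mult_less_cancel_left_pos by blast
    then show "1 / real n \<le> 2 * (s n - s (Suc n))"
      using npos by (simp add: field_simps)
  qed simp
  then show ?thesis by (simp add: s_def R_def)
qed

lemma ideal_star_lim_of_summable:
  fixes a :: "nat \<Rightarrow> real"
  assumes I: "ideal_on_nats I" and sub: "summable_ideal \<subseteq> I"
    and nonneg: "\<And>n. a n \<ge> 0" and sum: "summable a"
  shows "ideal_star_lim I (\<lambda>n. real n * a n) 0"
proof -
  define s where "s n = sqrt (\<Sum>k. a (k + n))" for n
  define A where "A = {n. real n * a n > s n}"
  have "s \<longlonglongrightarrow> 0"
    using tendsto_real_sqrt[OF suminf_tail_tendsto_0[OF sum]] by (simp add: s_def[abs_def])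
  \<comment> \<open>Index 0 has to be kept out of \<open>A\<close>, because members of
    \<open>summable_ideal\<close> are subsets of \<open>pos_nats\<close>.\<close>
  have "s 0 \<ge> 0"
    unfolding s_def by (simp add: suminf_nonneg sum nonneg)
  then have "0 \<notin> A" by (simp add: A_def)
  then have "A \<subseteq> pos_nats" by (metis One_nat_def Suc_leI atLeast_iff neq0_conv subsetI)
  then have "A \<in> I"
    using summable_on_inverse_sqrt_tail[OF nonneg sum] sub
    by (auto simp: summable_ideal_def A_def s_def)
  define F where "F = pos_nats - A"
  have F: "F \<in> dual_filter I" using \<open>A \<in> I\<close> by (auto simp: F_def dual_filter_def)
  then have inf: "infinite F" by (rule infinite_dual_filter[OF I])
  \<comment> \<open>The values of \<open>s\<close> along \<open>F\<close> form a genuine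
    subsequence, so they inherit the limit 0 and serve as the upper bound in the sandwich.\<close>
  have "strict_mono (enumerate F)" by (rule strict_mono_enumerate[OF inf])
  from LIMSEQ_subseq_LIMSEQ[OF \<open>s \<longlonglongrightarrow> 0\<close> this]
  have upper: "(\<lambda>k. s (enumerate F k)) \<longlonglongrightarrow> 0" by (simp add: o_def)
  have "real (enumerate F k) * a (enumerate F k) \<le> s (enumerate F k)" for k
    using enumerate_in_set[OF inf, of k] by (simp add: F_def A_def)
  then have "(\<lambda>k. real (enumerate F k) * a (enumerate F k)) \<longlonglongrightarrow> 0"
    by (intro tendsto_sandwich[OF _ _ tendsto_const upper]) (auto simp: nonneg)
  with F show ?thesis by (auto simp: ideal_star_lim_def)
qed

text \<open>The test sequence is \<open>1 / n\<close> on \<open>A\<close> and 0 elsewhere. Then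
  \<open>n * a n\<close> is the indicator function of \<open>A\<close>, so the threshold 1 recovers
  \<open>A\<close>.\<close>

lemma summable_ideal_subset_of_ideal_lim:
  assumes I: "ideal_on_nats I"
    and lim: "\<And>a :: nat \<Rightarrow> real. (\<And>n. a n \<ge> 0) \<Longrightarrow> summable a \<Longrightarrow>
      ideal_lim I (\<lambda>n. real n * a n) 0"
  shows "summable_ideal \<subseteq> I"
proof
  fix A assume "A \<in> summable_ideal"
  then have A: "A \<subseteq> pos_nats" "(\<lambda>n. 1 / real n) summable_on A"
    by (auto simp: summable_ideal_def)
  define a :: "nat \<Rightarrow> real" where "a n = (if n \<in> A then 1 / real n else 0)" for n
  have "a summable_on UNIV"
    using A(2) by (rule summable_on_cong_neutral[THEN iffD1, rotated -1]) (auto simp: a_def)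
  then have "summable a" by (rule summable_on_imp_summable)
  then have "ideal_lim I (\<lambda>n. real n * a n) 0" by (intro lim) (simp add: a_def)
  then have "{n \<in> pos_nats. \<bar>real n * a n - 0\<bar> \<ge> 1} \<in> I"
    unfolding ideal_lim_def by (meson zero_less_one)
  moreover have "A \<subseteq> {n \<in> pos_nats. \<bar>real n * a n - 0\<bar> \<ge> 1}"
    using A(1) by (auto simp: a_def)
  ultimately show "A \<in> I" using I by (auto simp: ideal_on_nats_def)
qed

theorem corollary2p4:
  fixes I :: "nat set set"
  assumes "ideal_on_nats I"
  shows "((\<forall>a :: nat \<Rightarrow> real. (\<forall>n\<ge>1. a n \<ge> 0) \<longrightarrow> summable (\<lambda>n. a (Suc n)) \<longrightarrow>
             ideal_lim I (\<lambda>n. real n * a n) 0)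
          \<longleftrightarrow>
          (\<forall>a :: nat \<Rightarrow> real. (\<forall>n\<ge>1. a n \<ge> 0) \<longrightarrow> summable (\<lambda>n. a (Suc n)) \<longrightarrow>
             ideal_star_lim I (\<lambda>n. real n * a n) 0))
       \<and> ((\<forall>a :: nat \<Rightarrow> real. (\<forall>n\<ge>1. a n \<ge> 0) \<longrightarrow> summable (\<lambda>n. a (Suc n)) \<longrightarrow>
             ideal_star_lim I (\<lambda>n. real n * a n) 0)
          \<longleftrightarrow>
          summable_ideal \<subseteq> I)"
proof -
  let ?hyp = "\<lambda>a :: nat \<Rightarrow> real. (\<forall>n\<ge>1. a n \<ge> 0) \<and> summable (\<lambda>n. a (Suc n))"
  have star_imp_lim: "ideal_lim I x L" if "ideal_star_lim I x L" for x L
    using ideal_star_lim_imp_ideal_lim[OF assms that] .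
  have lim_imp_sub: "summable_ideal \<subseteq> I"
    if "\<And>a. ?hyp a \<Longrightarrow> ideal_lim I (\<lambda>n. real n * a n) 0"
    \<comment> \<open>The test sequences of the lemma satisfy \<open>?hyp\<close>, since a shift of
      the index by one preserves summability.\<close>
    by (rule summable_ideal_subset_of_ideal_lim[OF assms that]) (simp add: summable_Suc_iff)
  have sub_imp_star: "ideal_star_lim I (\<lambda>n. real n * a n) 0"
    if sub: "summable_ideal \<subseteq> I" and a: "?hyp a" for a
  proof -
    \<comment> \<open>\<open>?hyp\<close> leaves \<open>a 0\<close> free, possibly negative, whereas
      the lemma applied here asks for nonnegativity at every index. Resetting the value at 0 leaves
      \<open>n * a n\<close> unchanged, as the factor \<open>n\<close> vanishes there.\<close>
    define b where "b n = (if n = 0 then 0 else a n)" for n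
    have "summable (\<lambda>n. b (Suc n))" using a by (simp add: b_def)
    then have "summable b" by (simp only: summable_Suc_iff)
    then have "ideal_star_lim I (\<lambda>n. real n * b n) 0"
      using a by (intro ideal_star_lim_of_summable[OF assms sub]) (simp add: b_def)
    moreover have "(\<lambda>n. real n * b n) = (\<lambda>n. real n * a n)" by (auto simp: b_def)
    ultimately show ?thesis by simp
  qed
  \<comment> \<open>The implications close the cycle (2), (1), (3), (2).\<close>
  show ?thesis
    using star_imp_lim lim_imp_sub sub_imp_star by meson
qed

end
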